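(* Let $\mathcal{X}\subseteq\mathbb{R}$, let $\mathcal{B}\subseteq\mathbb{R}$ be convex, and let $J:\mathcal{X}\times\mathcal{B}\to\mathbb{R}$ be continuous, concave in $b$ on $\mathcal{B}$ for every $x\in\mathcal{X}$, and concave in $x$ on $\mathcal{X}$ for every $b\in\mathcal{B}$. Let $g_1,\dots,g_n:\mathcal{X}\to\mathbb{R}$ be measurable and let $\epsilon=(\epsilon_1,\dots,\epsilon_n)\in\mathbb{R}^n$. Assume that there exists a probability distribution $F$ on $\mathcal{X}$ such that $\mathbb{E}_{x\sim F}\,g_i(x)<\epsilon_i$ for all $i=1,\dots,n$. Let $\mathcal{F}(\epsilon)$ be the set of all probability distributions $F$ on $\mathcal{X}$ with $\mathbb{E}_{x\sim F}\,g_i(x)\le\epsilon_i$ for $i=1,\dots,n$. Then the robust planning problem $$P^*(\epsilon)=\sup_{b\in\mathcal{B}}\ \inf_{F\in\mathcal{F}(\epsilon)}\ \mathbb{E}_{x\sim F}\,J(x,b)$$ is equivalent to the optimization problem $$\begin{aligned}\underset{b,\lambda,\eta}{\text{maximize}}\quad & -\sum_{i=1}^n\lambda_i\epsilon_i-\eta\\ \text{subject to}\quad & J(x,b)+\sum_{i=1}^n\lambda_i g_i(x)+\eta\ge 0\quad\text{for all }x\in\mathcal{X},\\ & b\in\mathcal{B},\ \lambda\in\mathbb{R}^n_+,\ \eta\in\mathbb{R}.\end{aligned}$$ That is, the optimal value of the second problem equals $P^*(\epsilon)$, and a decision $b\in\mathcal{B}$ is optimal for the robust planning problem if and only if it is the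 $b$-component of an optimal solution $(b,\lambda,\eta)$ of the second problem.
   Context: $\mathbb{R}^n_+$ is the set of vectors with nonnegative entries. $\mathcal{X}$ carries its Borel $\sigma$-algebra; a probability distribution on $\mathcal{X}$ is a Borel probability measure on $\mathcal{X}$, and $\mathbb{E}_{x\sim F}\,h(x)=\int_{\mathcal{X}}h\,dF$. Only distributions for which the integrals in question are defined are considered: the conditions $\mathbb{E}_{x\sim F}\,g_i(x)\le\epsilon_i$ (or $<\epsilon_i$) include that $g_i$ is $F$-integrable, and the infimum of $\mathbb{E}_{x\sim F}\,J(x,b)$ is taken over those $F\in\mathcal{F}(\epsilon)$ for which $J(\cdot,b)$ is $F$-integrable. Optimal values are suprema/infima in $[-\infty,+\infty]$ (with $\sup\emptyset=-\infty$, $\inf\emptyset=+\infty$). A decision $b\in\mathcal{B}$ is optimal for the robust planning problem if $\inf_{F\in\mathcal{F}(\epsilon)}\mathbb{E}_{x\sim F}\,J(x,b)=P^*(\epsilon)$ with $P^*(\epsilon)$ finite; an optimal solution of the second problem is a feasible point attaining its (finite) optimal value. Concavity in $x$ on $\mathcal{X}$ means that the concavity inequality holds whenever all points involved lie in $\mathcal{X}$. *)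

theory Defs
  imports "HOL-Probability.Probability"
begin

text \<open>The library's \<^const>\<open>concave_on\<close> requires its domain to be convex. Here the domain is arbitrary,
  and the inequality is imposed whenever all points involved lie in it.\<close>

definition concave_within :: "real set \<Rightarrow> (real \<Rightarrow> real) \<Rightarrow> bool" where
  "concave_within X f \<longleftrightarrow>
     (\<forall>x\<in>X. \<forall>y\<in>X. \<forall>t\<in>{0..1}. (1 - t) * x + t * y \<in> X \<longrightarrow>
        (1 - t) * f x + t * f y \<le> f ((1 - t) * x + t * y))"

text \<open>\<open>X\<close> need not be a Borel subset of the line; its Borel \<open>\<sigma>\<close>-algebra is the trace of \<^const>\<open>borel\<close>.\<close>

definition distributions :: "real set \<Rightarrow> real measure set" where
  "distributions X = {F. prob_space F \<and> sets F = sets (restrict_space borel X)}"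

definition ambiguity_set ::
    "real set \<Rightarrow> ('n::finite \<Rightarrow> real \<Rightarrow> real) \<Rightarrow> real ^ 'n \<Rightarrow> real measure set" where
  "ambiguity_set X g \<epsilon> =
     {F \<in> distributions X. \<forall>i. integrable F (g i) \<and> (\<integral>x. g i x \<partial>F) \<le> \<epsilon> $ i}"

definition worst_case ::
    "real set \<Rightarrow> ('n::finite \<Rightarrow> real \<Rightarrow> real) \<Rightarrow> real ^ 'n \<Rightarrow> (real \<Rightarrow> real \<Rightarrow> real) \<Rightarrow> real \<Rightarrow> ereal" where
  "worst_case X g \<epsilon> J b =
     (INF F \<in> {F \<in> ambiguity_set X g \<epsilon>. integrable F (\<lambda>x. J x b)}. ereal (\<integral>x. J x b \<partial>F))"

definition robust_value ::
    "real set \<Rightarrow> real set \<Rightarrow> ('n::finite \<Rightarrow> real \<Rightarrow> real) \<Rightarrow> real ^ 'n \<Rightarrow> (real \<Rightarrow> real \<Rightarrow> real) \<Rightarrow> ereal" where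
  "robust_value X B g \<epsilon> J = (SUP b \<in> B. worst_case X g \<epsilon> J b)"

definition robust_optimal ::
    "real set \<Rightarrow> real set \<Rightarrow> ('n::finite \<Rightarrow> real \<Rightarrow> real) \<Rightarrow> real ^ 'n \<Rightarrow> (real \<Rightarrow> real \<Rightarrow> real) \<Rightarrow> real \<Rightarrow> bool" where
  "robust_optimal X B g \<epsilon> J b \<longleftrightarrow>
     b \<in> B \<and> \<bar>robust_value X B g \<epsilon> J\<bar> \<noteq> \<infinity> \<and> worst_case X g \<epsilon> J b = robust_value X B g \<epsilon> J"

definition dual_feasible ::
    "real set \<Rightarrow> real set \<Rightarrow> ('n::finite \<Rightarrow> real \<Rightarrow> real) \<Rightarrow> (real \<Rightarrow> real \<Rightarrow> real) \<Rightarrow> (real \<times> (real ^ 'n) \<times> real) set" where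
  "dual_feasible X B g J =
     {(b, l, \<eta>). b \<in> B \<and> (\<forall>i. 0 \<le> l $ i) \<and>
        (\<forall>x\<in>X. J x b + (\<Sum>i\<in>UNIV. l $ i * g i x) + \<eta> \<ge> 0)}"

definition dual_objective :: "real ^ 'n::finite \<Rightarrow> real ^ 'n \<Rightarrow> real \<Rightarrow> real" where
  "dual_objective \<epsilon> l \<eta> = - (\<Sum>i\<in>UNIV. l $ i * \<epsilon> $ i) - \<eta>"

definition dual_value ::
    "real set \<Rightarrow> real set \<Rightarrow> ('n::finite \<Rightarrow> real \<Rightarrow> real) \<Rightarrow> real ^ 'n \<Rightarrow> (real \<Rightarrow> real \<Rightarrow> real) \<Rightarrow> ereal" where
  "dual_value X B g \<epsilon> J =
     (SUP (b, l, \<eta>) \<in> dual_feasible X B g J. ereal (dual_objective \<epsilon> l \<eta>))"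

text \<open>Finiteness of the optimal value is implied, since the attained objective value is real.\<close>

definition dual_optimal ::
    "real set \<Rightarrow> real set \<Rightarrow> ('n::finite \<Rightarrow> real \<Rightarrow> real) \<Rightarrow> real ^ 'n \<Rightarrow> (real \<Rightarrow> real \<Rightarrow> real) \<Rightarrow>
      real \<Rightarrow> real ^ 'n \<Rightarrow> real \<Rightarrow> bool" where
  "dual_optimal X B g \<epsilon> J b l \<eta> \<longleftrightarrow>
     (b, l, \<eta>) \<in> dual_feasible X B g J \<and> ereal (dual_objective \<epsilon> l \<eta>) = dual_value X B g \<epsilon> J"

end

theory Submission
  imports Defs
begin

text \<open>The decision \<open>b\<close> plays no role in the duality: for fixed \<open>b\<close> this is strong duality for the moment
  problem in \<open>F\<close>. If \<open>r\<close> is a lower bound for the worst-case expectation, then no finitely supported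
  distribution has moments \<open>u \<le> \<epsilon>\<close> and expected payoff \<open>t < r\<close>, so the convex hull of the curve
  \<open>x \<mapsto> (g x, J x b)\<close> can be separated from the convex set of such pairs \<open>(u, t)\<close>. The Slater point makes
  the separating hyperplane non-vertical, and normalising it yields a dual feasible point with
  objective at least \<open>r\<close>; for finite worst-case value this gives attainment.\<close>

text \<open>The convex weights form a distribution on finitely many values of \<open>h\<close>.
  Pushing it forward along a choice of preimages in \<open>X\<close> leaves the mean of
  \<open>h\<close> unchanged, so points of the hull become expectations.\<close>

lemma convex_hull_imp_pmf_expectation:
  fixes h :: "'a \<Rightarrow> 'b::euclidean_space"
  assumes "y \<in> convex hull (h ` X)"
  obtains p where "finite (set_pmf p)" "set_pmf p \<subseteq> X" "measure_pmf.expectation p h = y"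
proof -
  obtain S u where S: "finite S" "S \<subseteq> h ` X" and u: "\<And>v. v \<in> S \<Longrightarrow> 0 \<le> u v"
    and sum: "sum u S = 1" and y: "(\<Sum>v\<in>S. u v *\<^sub>R v) = y"
    using assms unfolding convex_hull_explicit by auto
  \<comment> \<open>The weights \<open>u\<close> are known to be nonnegative only on
    \<open>S\<close>, while \<open>embed_pmf\<close> needs a function on the whole type. Hence the
    extension by zero.\<close>
  define w where "w v = (if v \<in> S then u v else 0)" for v
  have w: "0 \<le> w v" for v
    using u by (simp add: w_def)
  have "(\<integral>\<^sup>+v. ennreal (w v) \<partial>count_space UNIV) = (\<Sum>v\<in>S. ennreal (w v))"
    by (rule nn_integral_count_space'[OF S(1)]) (auto simp: w_def split: if_splits)
  also have "\<dots> = ennreal (sum w S)"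
    using w by (simp add: sum_ennreal)
  also have "\<dots> = 1"
    using sum by (simp add: w_def)
  finally have w_pmf: "pmf (embed_pmf w) v = w v" for v
    using w by (intro pmf_embed_pmf)
  define q where "q = embed_pmf w"
  have q: "set_pmf q \<subseteq> S"
    by (auto simp: set_pmf_iff q_def w_pmf w_def split: if_splits)
  define p where "p = map_pmf (inv_into X h) q"
  have "measure_pmf.expectation p h = measure_pmf.expectation q (\<lambda>v. h (inv_into X h v))"
    by (simp add: p_def)
  also have "\<dots> = (\<Sum>v\<in>S. pmf q v *\<^sub>R h (inv_into X h v))"
    using S(1) q by (intro integral_measure_pmf) auto
  also have "\<dots> = (\<Sum>v\<in>S. u v *\<^sub>R v)"
    using S(2) by (intro sum.cong) (simp_all add: q_def w_pmf w_def f_inv_into_f subset_eq)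
  finally have "measure_pmf.expectation p h = y"
    using y by simp
  moreover have "finite (set_pmf p)"
    using finite_subset[OF q S(1)] by (simp add: p_def)
  moreover have "set_pmf p \<subseteq> X"
    using q S(2) by (auto simp: p_def intro!: inv_into_into)
  ultimately show thesis
    using that by blast
qed

text \<open>A \<open>pmf\<close> lives on all subsets of the line, whereas
  \<open>distributions X\<close> asks for the trace Borel algebra on \<open>X\<close>; this lemma
  passes from one to the other. Integrability is automatic because the support is finite.\<close>

lemma distribution_of_finite_pmf:
  fixes p :: "real pmf"
  assumes "finite (set_pmf p)" and "set_pmf p \<subseteq> X"
  obtains F where "F \<in> distributions X"
    "\<And>f. f \<in> borel_measurable (restrict_space borel X) \<Longrightarrow>
       integrable F f \<and> (\<integral>x. f x \<partial>F) = (measure_pmf.expectation p f :: real)"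
proof -
  obtain x0 where x0: "x0 \<in> X"
    using assms(2) set_pmf_not_empty[of p] by auto
  \<comment> \<open>Points outside \<open>X\<close> carry no mass, but a measurable map into the
    trace space must send them into \<open>X\<close> too; \<open>x0\<close> is an arbitrary target
    for them.\<close>
  define k where "k x = (if x \<in> X then x else x0)" for x
  let ?M = "restrict_space borel X"
  let ?F = "distr (measure_pmf p) ?M k"
  have k: "k \<in> measurable (measure_pmf p) ?M"
    using x0 by (auto simp: k_def space_restrict_space)
  have kp: "k x = x" if "x \<in> set_pmf p" for x
    using that assms(2) by (auto simp: k_def)
  have "?F \<in> distributions X"
    using measure_pmf.prob_space_distr[OF k] by (simp add: distributions_def)
  moreover have "integrable ?F f \<and> (\<integral>x. f x \<partial>?F) = measure_pmf.expectation p f"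
    if f: "f \<in> borel_measurable ?M" for f :: "real \<Rightarrow> real"
  proof -
    have "integrable ?F f"
      using assms(1) by (simp add: integrable_distr_eq[OF k f] integrable_measure_pmf_finite)
    moreover have "measure_pmf.expectation p (\<lambda>x. f (k x)) = measure_pmf.expectation p f"
      by (rule integral_cong_AE) (auto simp: AE_measure_pmf_iff kp)
    ultimately show ?thesis
      by (simp add: integral_distr[OF k f])
  qed
  ultimately show thesis
    using that by blast
qed

lemma nonneg_if_ray_bounded_above:
  fixes a :: real
  assumes "\<And>s. 0 \<le> s \<Longrightarrow> p - s * a \<le> c"
  shows "0 \<le> a"
proof (rule ccontr)
  assume "\<not> 0 \<le> a"
  then have a: "a < 0" by simp
  \<comment> \<open>With this \<open>s\<close> the left side equals
    \<open>p + \<bar>c - p\<bar> + 1\<close>, which exceeds \<open>c\<close>.\<close>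
  have "p - (\<bar>c - p\<bar> + 1) / (- a) * a \<le> c"
    using a by (intro assms divide_nonneg_pos) auto
  then show False
    using a by simp
qed

text \<open>Weak duality: integrate the feasibility constraint against \<open>F\<close>, then use
  \<open>l \<ge> 0\<close> to replace each moment by its bound.\<close>

lemma worst_case_ge_dual_objective:
  assumes "(b, l, \<eta>) \<in> dual_feasible X B g J"
  shows "ereal (dual_objective \<epsilon> l \<eta>) \<le> worst_case X g \<epsilon> J b"
  unfolding worst_case_def
proof (rule INF_greatest)
  fix F assume "F \<in> {F \<in> ambiguity_set X g \<epsilon>. integrable F (\<lambda>x. J x b)}"
  then have "prob_space F" and sets: "sets F = sets (restrict_space borel X)"
    and g: "\<And>i. integrable F (g i)" "\<And>i. (\<integral>x. g i x \<partial>F) \<le> \<epsilon> $ i"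
    and J: "integrable F (\<lambda>x. J x b)"
    by (auto simp: ambiguity_set_def distributions_def)
  interpret prob_space F by fact
  have X: "space F = X"
    using sets_eq_imp_space_eq[OF sets] by (simp add: space_restrict_space)
  have l: "\<And>i. 0 \<le> l $ i" and feas: "\<And>x. x \<in> X \<Longrightarrow> J x b + (\<Sum>i\<in>UNIV. l $ i * g i x) + \<eta> \<ge> 0"
    using assms by (auto simp: dual_feasible_def)
  have "0 \<le> (\<integral>x. J x b + (\<Sum>i\<in>UNIV. l $ i * g i x) + \<eta> \<partial>F)"
    using feas X by (intro integral_nonneg_AE) auto
  also have "\<dots> = (\<integral>x. J x b \<partial>F) + (\<Sum>i\<in>UNIV. l $ i * (\<integral>x. g i x \<partial>F)) + \<eta>"
    using J g by (simp add: prob_space)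
  also have "\<dots> \<le> (\<integral>x. J x b \<partial>F) + (\<Sum>i\<in>UNIV. l $ i * \<epsilon> $ i) + \<eta>"
    using l g by (intro add_mono sum_mono mult_left_mono) auto
  finally show "ereal (dual_objective \<epsilon> l \<eta>) \<le> ereal (\<integral>x. J x b \<partial>F)"
    by (simp add: dual_objective_def)
qed

text \<open>Strong duality, phrased with a real lower bound \<open>r\<close> instead of the
  worst-case value so that it also covers an infinite value.\<close>

lemma dual_feasible_above_lower_bound:
  fixes g :: "'n::finite \<Rightarrow> real \<Rightarrow> real" and \<epsilon> :: "real ^ 'n"
  assumes b: "b \<in> B"
    and J: "(\<lambda>x. J x b) \<in> borel_measurable (restrict_space borel X)"
    and g: "\<And>i. g i \<in> borel_measurable (restrict_space borel X)"
    and F: "F \<in> distributions X" "\<And>i. integrable F (g i)" "\<And>i. (\<integral>x. g i x \<partial>F) < \<epsilon> $ i"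
    and r: "ereal r \<le> worst_case X g \<epsilon> J b"
  obtains l \<eta> where "(b, l, \<eta>) \<in> dual_feasible X B g J" "r \<le> dual_objective \<epsilon> l \<eta>"
proof -
  define h where "h x = ((\<chi> i. g i x) :: real ^ 'n, J x b)" for x
  \<comment> \<open>The inequality in \<open>t\<close> is strict, so a hull point in
    \<open>K\<close> would have payoff strictly below \<open>r\<close>, even if the infimum equals
    \<open>r\<close> and is attained.\<close>
  define K where "K = {(u :: real ^ 'n, t). (\<forall>i. u $ i \<le> \<epsilon> $ i) \<and> t < r}"
  interpret prob_space F
    using F(1) by (simp add: distributions_def)
  have X: "space F = X"
    using F(1) sets_eq_imp_space_eq[of F "restrict_space borel X"]
    by (auto simp: distributions_def space_restrict_space)
  have "convex K"
  proof -
    have "K = (\<Inter>i. {u. axis i 1 \<bullet> u \<le> \<epsilon> $ i}) \<times> {..<r}"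
      by (auto simp: K_def inner_axis')
    then show ?thesis
      by (simp add: convex_Times convex_INT convex_halfspace_le convex_real_interval)
  qed
  moreover have "K \<inter> convex hull (h ` X) = {}"
  proof (rule ccontr)
    assume "K \<inter> convex hull (h ` X) \<noteq> {}"
    then obtain u t where K: "(u, t) \<in> K" and "(u, t) \<in> convex hull (h ` X)"
      by auto
    then obtain p where p: "finite (set_pmf p)" "set_pmf p \<subseteq> X"
      and exp: "measure_pmf.expectation p h = (u, t)"
      using convex_hull_imp_pmf_expectation by blast
    obtain G where G: "G \<in> distributions X"
      and int: "\<And>f. f \<in> borel_measurable (restrict_space borel X) \<Longrightarrow>
         integrable G f \<and> (\<integral>x. f x \<partial>G) = (measure_pmf.expectation p f :: real)"
      by (rule distribution_of_finite_pmf[OF p]) blast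
    have ih: "integrable (measure_pmf p) h"
      using p(1) by (rule integrable_measure_pmf_finite)
    \<comment> \<open>Coordinate projections are bounded linear and so commute with the
      vector-valued expectation.\<close>
    have "measure_pmf.expectation p (g i) = u $ i" for i
    proof -
      have "bounded_linear (\<lambda>z :: (real ^ 'n) \<times> real. fst z $ i)"
        by (rule bounded_linear_compose[OF bounded_linear_vec_nth bounded_linear_fst])
      from integral_bounded_linear[OF this ih] show ?thesis
        by (simp add: exp h_def)
    qed
    moreover have "measure_pmf.expectation p (\<lambda>x. J x b) = t"
      using integral_bounded_linear[OF bounded_linear_snd ih] by (simp add: exp h_def)
    ultimately have "worst_case X g \<epsilon> J b \<le> ereal t"
      unfolding worst_case_def using G K int[OF J] int[OF g]
      by (intro INF_lower2[of G]) (auto simp: ambiguity_set_def K_def)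
    then show False
      using r K order_trans by (fastforce simp: K_def)
  qed
  moreover have "K \<noteq> {}"
  proof -
    have "(\<epsilon>, r - 1) \<in> K"
      by (simp add: K_def)
    then show ?thesis
      by blast
  qed
  moreover have "convex hull (h ` X) \<noteq> {}"
    using X not_empty by simp
  ultimately obtain z c where z: "z \<noteq> 0" and below: "\<And>y. y \<in> K \<Longrightarrow> z \<bullet> y \<le> c"
    and above: "\<And>y. y \<in> convex hull (h ` X) \<Longrightarrow> c \<le> z \<bullet> y"
    using separating_hyperplane_sets[of K "convex hull (h ` X)"] convex_convex_hull by metis
  obtain a m where am: "z = (a, m)"
    by fastforce
  have below: "a \<bullet> u + m * t \<le> c" if "\<And>i. u $ i \<le> \<epsilon> $ i" "t < r" for u t
    using below[of "(u, t)"] that by (simp add: K_def am)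
  have above: "c \<le> (\<Sum>i\<in>UNIV. a $ i * g i x) + m * J x b" if "x \<in> X" for x
    using above[of "h x"] that by (simp add: h_def am inner_vec_def hull_inc)
  \<comment> \<open>\<open>K\<close> recedes to minus infinity in every coordinate, so a negative
    component of the normal would make the functional unbounded above on \<open>K\<close>.\<close>
  have a: "0 \<le> a $ i" for i
  proof (rule nonneg_if_ray_bounded_above)
    fix s :: real assume "0 \<le> s"
    then have "a \<bullet> (\<epsilon> - s *\<^sub>R axis i 1) + m * (r - 1) \<le> c"
      by (intro below) (auto simp: axis_def)
    then show "a \<bullet> \<epsilon> + m * (r - 1) - s * a $ i \<le> c"
      by (simp add: inner_diff_right inner_axis)
  qed
  have m: "0 \<le> m"
  proof (rule nonneg_if_ray_bounded_above)
    fix s :: real assume "0 \<le> s"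
    then show "a \<bullet> \<epsilon> + m * (r - 1) - s * m \<le> c"
      using below[of \<epsilon> "r - 1 - s"] by (simp add: algebra_simps)
  qed
  \<comment> \<open>The corner \<open>(\<epsilon>, r)\<close> lies outside \<open>K\<close>; the
    bound is reached there as a limit along \<open>(\<epsilon>, t)\<close> with \<open>t\<close>
    increasing to \<open>r\<close>.\<close>
  have lim: "a \<bullet> \<epsilon> + m * r \<le> c"
  proof (rule tendsto_upperbound)
    show "((\<lambda>t. a \<bullet> \<epsilon> + m * t) \<longlongrightarrow> a \<bullet> \<epsilon> + m * r) (at_left r)"
      by (intro tendsto_intros)
    show "\<forall>\<^sub>F t in at_left r. a \<bullet> \<epsilon> + m * t \<le> c"
      using below by (auto simp: eventually_at_filter)
  qed simp
  \<comment> \<open>If \<open>m = 0\<close>, then \<open>a\<close> has a positive component.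
    Integrating \<open>above\<close> against the Slater distribution gives
    \<open>c < a \<bullet> \<epsilon>\<close>, which contradicts \<open>lim\<close>.\<close>
  have "m \<noteq> 0"
  proof
    assume "m = 0"
    then obtain j where "a $ j \<noteq> 0"
      using z am by (auto simp: vec_eq_iff zero_prod_def)
    have "c = (\<integral>x. c \<partial>F)"
      by (simp add: prob_space)
    also have "\<dots> \<le> (\<integral>x. (\<Sum>i\<in>UNIV. a $ i * g i x) \<partial>F)"
      using above \<open>m = 0\<close> X F(2) by (intro integral_mono) auto
    also have "\<dots> = (\<Sum>i\<in>UNIV. a $ i * (\<integral>x. g i x \<partial>F))"
      using F(2) by simp
    also have "\<dots> < (\<Sum>i\<in>UNIV. a $ i * \<epsilon> $ i)"
    proof (rule sum_strict_mono_ex1)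
      show "\<forall>i\<in>UNIV. a $ i * (\<integral>x. g i x \<partial>F) \<le> a $ i * \<epsilon> $ i"
        using a F(3) by (simp add: mult_left_mono less_imp_le)
      show "\<exists>i\<in>UNIV. a $ i * (\<integral>x. g i x \<partial>F) < a $ i * \<epsilon> $ i"
        using \<open>a $ j \<noteq> 0\<close> a[of j] F(3)[of j] by (intro bexI[of _ j]) auto
    qed simp
    finally show False
      using lim \<open>m = 0\<close> by (simp add: inner_vec_def)
  qed
  with m have m: "0 < m" by simp
  \<comment> \<open>Scale the normal so that the payoff has coefficient 1. With
    \<open>- c / m\<close> for the offset, \<open>above\<close> becomes the dual constraint and
    \<open>lim\<close> becomes the bound on the objective.\<close>
  define l where "l = (1 / m) *\<^sub>R a"
  have sum_l: "(\<Sum>i\<in>UNIV. l $ i * v i) = (\<Sum>i\<in>UNIV. a $ i * v i) / m" for v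
    by (simp add: l_def sum_divide_distrib)
  have "J x b + (\<Sum>i\<in>UNIV. l $ i * g i x) + - c / m \<ge> 0" if "x \<in> X" for x
  proof -
    have "0 \<le> ((\<Sum>i\<in>UNIV. a $ i * g i x) + m * J x b - c) / m"
      using above[OF that] m by simp
    also have "\<dots> = J x b + (\<Sum>i\<in>UNIV. l $ i * g i x) + - c / m"
      using m unfolding sum_l by (simp add: add_divide_distrib diff_divide_distrib)
    finally show ?thesis .
  qed
  then have "(b, l, - c / m) \<in> dual_feasible X B g J"
    using a b m by (simp add: dual_feasible_def l_def)
  moreover have "r \<le> (c - a \<bullet> \<epsilon>) / m"
    using lim m by (simp add: field_simps)
  then have "r \<le> dual_objective \<epsilon> l (- c / m)"
    unfolding dual_objective_def sum_l by (simp add: inner_vec_def diff_divide_distrib)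
  ultimately show thesis
    using that by blast
qed

theorem theorem1:
  fixes X B :: "real set"
    and J :: "real \<Rightarrow> real \<Rightarrow> real"
    and g :: "'n::finite \<Rightarrow> real \<Rightarrow> real"
    and \<epsilon> :: "real ^ 'n"
  assumes "convex B"
    and "continuous_on (X \<times> B) (\<lambda>(x, b). J x b)"
    and "\<And>x. x \<in> X \<Longrightarrow> concave_on B (\<lambda>b. J x b)"
    and "\<And>b. b \<in> B \<Longrightarrow> concave_within X (\<lambda>x. J x b)"
    and "\<And>i. g i \<in> borel_measurable (restrict_space borel X)"
    and "\<exists>F \<in> distributions X. \<forall>i. integrable F (g i) \<and> (\<integral>x. g i x \<partial>F) < \<epsilon> $ i"
  shows "dual_value X B g \<epsilon> J = robust_value X B g \<epsilon> J \<and>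
    (\<forall>b\<in>B. robust_optimal X B g \<epsilon> J b \<longleftrightarrow> (\<exists>l \<eta>. dual_optimal X B g \<epsilon> J b l \<eta>))"
proof -
  obtain F where F: "F \<in> distributions X" "\<And>i. integrable F (g i)" "\<And>i. (\<integral>x. g i x \<partial>F) < \<epsilon> $ i"
    using assms(6) by auto
  let ?D = "dual_value X B g \<epsilon> J" and ?R = "robust_value X B g \<epsilon> J"
  have J: "(\<lambda>x. J x b) \<in> borel_measurable (restrict_space borel X)" if "b \<in> B" for b
  proof (rule borel_measurable_continuous_on_restrict)
    have "continuous_on X (\<lambda>x. (\<lambda>(x, b). J x b) (x, b))"
      by (rule continuous_on_compose2[OF assms(2)]) (use that in \<open>auto intro!: continuous_intros\<close>)
    then show "continuous_on X (\<lambda>x. J x b)"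
      by simp
  qed
  have strong: "\<exists>l \<eta>. (b, l, \<eta>) \<in> dual_feasible X B g J \<and> r \<le> dual_objective \<epsilon> l \<eta>"
    if "b \<in> B" "ereal r \<le> worst_case X g \<epsilon> J b" for b r
    using dual_feasible_above_lower_bound[OF that(1) J[OF that(1)] assms(5) F that(2)] by metis
  have obj_le: "ereal (dual_objective \<epsilon> l \<eta>) \<le> ?D" if "(b, l, \<eta>) \<in> dual_feasible X B g J" for b l \<eta>
    unfolding dual_value_def using that by (intro SUP_upper2[of "(b, l, \<eta>)"]) auto
  have wc_le: "worst_case X g \<epsilon> J b \<le> ?R" if "b \<in> B" for b
    unfolding robust_value_def using that by (rule SUP_upper)
  have feas_B: "b \<in> B" if "(b, l, \<eta>) \<in> dual_feasible X B g J" for b l \<eta>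
    using that by (simp add: dual_feasible_def)
  have eq: "?D = ?R"
  proof (rule antisym)
    show "?D \<le> ?R"
      unfolding dual_value_def
      using worst_case_ge_dual_objective wc_le feas_B by (fastforce intro!: SUP_least intro: order_trans)
    show "?R \<le> ?D"
      unfolding robust_value_def
    proof (rule SUP_least, rule ccontr)
      fix b assume b: "b \<in> B" and "\<not> worst_case X g \<epsilon> J b \<le> ?D"
      \<comment> \<open>A real number strictly between the two values treats finite and infinite
        worst-case values alike.\<close>
      then obtain r where r: "?D < ereal r" "ereal r < worst_case X g \<epsilon> J b"
        using ereal_dense2 by (meson not_le)
      then obtain l \<eta> where "(b, l, \<eta>) \<in> dual_feasible X B g J" "r \<le> dual_objective \<epsilon> l \<eta>"
        using strong[OF b] by (meson less_imp_le)
      then show False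
        using obj_le[of b l \<eta>] r(1) by (meson ereal_less_eq(3) leD order_trans)
    qed
  qed
  moreover have "robust_optimal X B g \<epsilon> J b \<longleftrightarrow> (\<exists>l \<eta>. dual_optimal X B g \<epsilon> J b l \<eta>)"
    if b: "b \<in> B" for b
  proof
    assume opt: "robust_optimal X B g \<epsilon> J b"
    then obtain v where v: "?R = ereal v"
      by (auto simp: robust_optimal_def)
    \<comment> \<open>Since \<open>v\<close> is itself a lower bound, strong duality at
      \<open>r = v\<close> yields a dual point that attains the optimum, not merely one that
      approximates it.\<close>
    then obtain l \<eta> where "(b, l, \<eta>) \<in> dual_feasible X B g J" "v \<le> dual_objective \<epsilon> l \<eta>"
      using strong[OF b, of v] opt by (auto simp: robust_optimal_def)
    then have "dual_optimal X B g \<epsilon> J b l \<eta>"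
      using obj_le[of b l \<eta>] eq v by (auto simp: dual_optimal_def)
    then show "\<exists>l \<eta>. dual_optimal X B g \<epsilon> J b l \<eta>"
      by blast
  next
    assume "\<exists>l \<eta>. dual_optimal X B g \<epsilon> J b l \<eta>"
    then obtain l \<eta> where feas: "(b, l, \<eta>) \<in> dual_feasible X B g J"
      and obj: "ereal (dual_objective \<epsilon> l \<eta>) = ?R"
      using eq by (auto simp: dual_optimal_def)
    \<comment> \<open>The worst case of \<open>b\<close> is squeezed between the dual objective,
      which equals the robust value here, and the robust value itself.\<close>
    have "worst_case X g \<epsilon> J b = ?R"
      using worst_case_ge_dual_objective[OF feas, of \<epsilon>] wc_le[OF b] obj by simp
    moreover have "\<bar>?R\<bar> \<noteq> \<infinity>"
      by (simp flip: obj)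
    ultimately show "robust_optimal X B g \<epsilon> J b"
      using b by (simp add: robust_optimal_def)
  qed
  ultimately show ?thesis
    by blast
qed

end
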